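(* Let $\mathbf{a}=(a_1,\dots,a_n)$ and $\mathbf{b}=(b_1,\dots,b_n)$ be $n$-tuples of nonnegative reals at most one of which is degenerate. If $\theta(\mathbf{a},\mathbf{b})=(\mathbf{b}',\mathbf{a}')$, then $$M(\mathbf{a})N(\mathbf{b})=N(\mathbf{b}')M(\mathbf{a}').$$
   Context: Fix $n\ge1$; indices of parameters are read modulo $n$. An $n$-tuple $\mathbf{a}\in\mathbb{R}_{\ge0}^n$ is degenerate if at least one $a_i$ is $0$. For $(\mathbf{a},\mathbf{b})$ with at most one of $\mathbf{a},\mathbf{b}$ degenerate, $\theta(\mathbf{a},\mathbf{b})=(\mathbf{b}',\mathbf{a}')$ where $$b'_i=\frac{(a_i+b_i)b_{i+1}}{a_{i+1}+b_{i+1}},\qquad a'_i=\frac{(a_i+b_i)a_{i+1}}{a_{i+1}+b_{i+1}}.$$ The whirl $M(\mathbf{a})$ is the doubly infinite matrix (indexed by $\mathbb{Z}\times\mathbb{Z}$) with $m_{i,i}=1$, $m_{i,i+1}=a_i$, other entries $0$. The curl $N(\mathbf{a})$ is the doubly infinite upper triangular matrix with $1$'s on the diagonal and $(i,j)$ entry $a_ia_{i+1}\cdots a_{j-1}$ for $i<j$. *)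

theory Defs
  imports Complex_Main "HOL-Library.Groups_Big_Fun"
begin

text \<open>
  An \<open>n\<close>-tuple \<open>(a\<^sub>1, \<dots>, a\<^sub>n)\<close> is a list of length \<open>n\<close>. Tuples are indexed from 1 and their
  indices are integers read modulo \<open>n\<close>, so that \<open>a\<^sub>i\<close> is stored at list position \<open>(i - 1) mod n\<close>.
\<close>

definition entry :: "real list \<Rightarrow> int \<Rightarrow> real" where
  "entry a i = a ! nat ((i - 1) mod int (length a))"

definition degenerate :: "real list \<Rightarrow> bool" where
  "degenerate a \<longleftrightarrow> (\<exists>x \<in> set a. x = 0)"

text \<open>
  The intended domain of \<open>theta\<close> is that of pairs of nonnegative tuples of the same positive length,
  at most one of them degenerate; all denominators are positive there.
\<close>

definition theta :: "real list \<Rightarrow> real list \<Rightarrow> real list \<times> real list" where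
  "theta a b =
    (map (\<lambda>i. (entry a i + entry b i) * entry b (i + 1) / (entry a (i + 1) + entry b (i + 1)))
       [1..int (length a)],
     map (\<lambda>i. (entry a i + entry b i) * entry a (i + 1) / (entry a (i + 1) + entry b (i + 1)))
       [1..int (length a)])"

type_synonym inf_matrix = "int \<Rightarrow> int \<Rightarrow> real"

definition whirl :: "real list \<Rightarrow> inf_matrix" where
  "whirl a i j = (if j = i then 1 else if j = i + 1 then entry a i else 0)"

definition curl :: "real list \<Rightarrow> inf_matrix" where
  "curl a i j = (if i = j then 1 else if i < j then \<Prod>k\<in>{i..<j}. entry a k else 0)"

text \<open>
  \<open>Sum_any\<close> is the sum over all integers \<open>k\<close>, meaningful when only finitely many summands are
  nonzero. This holds for upper triangular matrices, by \<open>finite_support_mat_prod\<close> below.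
\<close>

definition mat_prod :: "inf_matrix \<Rightarrow> inf_matrix \<Rightarrow> inf_matrix"  (infixl \<open>\<bullet>\<^sub>m\<close> 70) where
  "(X \<bullet>\<^sub>m Y) i j = Sum_any (\<lambda>k. X i k * Y k j)"

definition upper_triangular :: "inf_matrix \<Rightarrow> bool" where
  "upper_triangular X \<longleftrightarrow> (\<forall>i j. j < i \<longrightarrow> X i j = 0)"

lemma upper_triangular_whirl: "upper_triangular (whirl a)"
  by (auto simp: upper_triangular_def whirl_def)

lemma upper_triangular_curl: "upper_triangular (curl a)"
  by (auto simp: upper_triangular_def curl_def)

lemma finite_support_mat_prod:
  assumes "upper_triangular X" "upper_triangular Y"
  shows "finite {k. X i k * Y k j \<noteq> 0}"
proof (rule finite_subset)
  show "{k. X i k * Y k j \<noteq> 0} \<subseteq> {i..j}"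
    using assms by (force simp: upper_triangular_def not_less[symmetric])
qed simp

end

theory Submission
  imports Defs
begin

text \<open>
  Put \<open>s\<^sub>i = a\<^sub>i + b\<^sub>i\<close>. All entries are nonnegative and the two tuples are not both
  degenerate, so \<open>a\<^sub>i\<close> and \<open>b\<^sub>i\<close> never vanish together and every \<open>s\<^sub>i\<close> is positive.

  A whirl has only two nonzero diagonals, so multiplying by it adds two neighbouring entries of the
  other factor, one of them with a weight. Above the diagonal, two neighbouring entries of a curl
  share all factors of their products but one. Hence, for \<open>i < j\<close>, the \<open>(i, j)\<close> entry of
  \<open>M(a) N(b)\<close> is \<open>(a\<^sub>i + b\<^sub>i) b\<^sub>i\<^sub>+\<^sub>1 \<dots> b\<^sub>j\<^sub>-\<^sub>1\<close>, and that of
  \<open>N(b') M(a')\<close> is \<open>b'\<^sub>i \<dots> b'\<^sub>j\<^sub>-\<^sub>2 (a'\<^sub>j\<^sub>-\<^sub>1 + b'\<^sub>j\<^sub>-\<^sub>1)\<close>.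

  The map \<open>theta\<close> preserves the sums, \<open>a'\<^sub>k + b'\<^sub>k = s\<^sub>k\<close>, and
  \<open>b'\<^sub>k = (s\<^sub>k / s\<^sub>k\<^sub>+\<^sub>1) b\<^sub>k\<^sub>+\<^sub>1\<close>, so the product of the \<open>b'\<^sub>k\<close> telescopes to
  \<open>(s\<^sub>i / s\<^sub>j\<^sub>-\<^sub>1) b\<^sub>i\<^sub>+\<^sub>1 \<dots> b\<^sub>j\<^sub>-\<^sub>1\<close> (\<open>prod_telescope_shift\<close>). Both entries are therefore
  \<open>s\<^sub>i b\<^sub>i\<^sub>+\<^sub>1 \<dots> b\<^sub>j\<^sub>-\<^sub>1\<close>. On and below the diagonal both products agree with the identity matrix.
\<close>

lemma whirl_mat_prod: "(whirl a \<bullet>\<^sub>m X) i j = X i j + entry a i * X (i + 1) j"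
proof -
  have "(whirl a \<bullet>\<^sub>m X) i j = (\<Sum>k\<in>{i, i + 1}. whirl a i k * X k j)"
    unfolding mat_prod_def by (rule Sum_any.expand_superset) (auto simp: whirl_def)
  then show ?thesis by (simp add: whirl_def)
qed

lemma mat_prod_whirl: "(X \<bullet>\<^sub>m whirl a) i j = X i j + X i (j - 1) * entry a (j - 1)"
proof -
  have "(X \<bullet>\<^sub>m whirl a) i j = (\<Sum>k\<in>{j - 1, j}. X i k * whirl a k j)"
    unfolding mat_prod_def by (rule Sum_any.expand_superset) (auto simp: whirl_def)
  then show ?thesis by (simp add: whirl_def)
qed

lemma curl_eq_prod: "i \<le> j \<Longrightarrow> curl a i j = (\<Prod>k\<in>{i..<j}. entry a k)"
  by (auto simp: curl_def)

lemma curl_split_first: "i < j \<Longrightarrow> curl a i j = entry a i * curl a (i + 1) j"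
proof -
  assume "i < j"
  then have "{i..<j} = insert i {i + 1..<j}" by auto
  with \<open>i < j\<close> show ?thesis by (simp add: curl_eq_prod)
qed

lemma curl_split_last: "i < j \<Longrightarrow> curl a i j = curl a i (j - 1) * entry a (j - 1)"
proof -
  assume "i < j"
  then have "{i..<j} = insert (j - 1) {i..<j - 1}" by auto
  with \<open>i < j\<close> show ?thesis by (simp add: curl_eq_prod mult.commute)
qed

lemma prod_telescope_shift:
  fixes s b :: "int \<Rightarrow> 'a::field"
  assumes s: "\<And>k. s k \<noteq> 0" and "i \<le> m"
  shows "(\<Prod>k\<in>{i..<m}. s k * b (k + 1) / s (k + 1)) * s m = s i * (\<Prod>k\<in>{i + 1..<m + 1}. b k)"
  using \<open>i \<le> m\<close>
proof (induction m rule: int_ge_induct)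
  case base
  then show ?case by simp
next
  case (step m)
  have left: "{i..<m + 1} = insert m {i..<m}"
    and right: "{i + 1..<m + 1 + 1} = insert (m + 1) {i + 1..<m + 1}"
    using step.hyps by auto
  show ?case
    using step.IH s[of "m + 1"] unfolding left right
    by (simp add: mult.assoc mult.left_commute[of _ "b (m + 1)"] mult.commute[of _ "s m"])
qed

text \<open>
  A list that tabulates an \<open>n\<close>-periodic function over one period represents that function at
  every integer index. This turns the defining formulas of \<open>theta\<close>, which only speak of the
  indices from \<open>1\<close> to \<open>n\<close>, into identities for all indices.
\<close>

lemma entry_map_upto:
  assumes "n \<ge> 1" and periodic: "\<And>i. f ((i - 1) mod int n + 1) = f i"
  shows "entry (map f [1..int n]) i = f i"
proof -
  have "nat ((i - 1) mod int n) < n"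
    using assms(1) by (simp add: nat_less_iff)
  then have "entry (map f [1..int n]) i = f ((i - 1) mod int n + 1)"
    using assms(1) by (simp add: entry_def nth_upto add.commute)
  with periodic show ?thesis by simp
qed

lemma entry_mod:
  assumes "length a = n"
  shows "entry a ((i - 1) mod int n + 1) = entry a i"
    and "entry a ((i - 1) mod int n + 1 + 1) = entry a (i + 1)"
  using assms mod_add_left_eq[of "i - 1" "int n" 1] by (simp_all add: entry_def add.commute)

lemma entry_theta:
  assumes "length a = n" "length b = n" "n \<ge> 1" and "theta a b = (b', a')"
  shows "entry b' i = (entry a i + entry b i) * entry b (i + 1) / (entry a (i + 1) + entry b (i + 1))"
    and "entry a' i = (entry a i + entry b i) * entry a (i + 1) / (entry a (i + 1) + entry b (i + 1))"
proof -
  note ab_mod = entry_mod[OF assms(1)] entry_mod[OF assms(2)]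
  have "b' = map (\<lambda>i. (entry a i + entry b i) * entry b (i + 1) / (entry a (i + 1) + entry b (i + 1)))
      [1..int n]"
    and "a' = map (\<lambda>i. (entry a i + entry b i) * entry a (i + 1) / (entry a (i + 1) + entry b (i + 1)))
      [1..int n]"
    using assms by (auto simp: theta_def)
  then show "entry b' i = (entry a i + entry b i) * entry b (i + 1) / (entry a (i + 1) + entry b (i + 1))"
    and "entry a' i = (entry a i + entry b i) * entry a (i + 1) / (entry a (i + 1) + entry b (i + 1))"
    by (simp_all only: entry_map_upto[OF \<open>n \<ge> 1\<close>] ab_mod)
qed

lemma entry_in_set: "length a \<ge> 1 \<Longrightarrow> entry a i \<in> set a"
  unfolding entry_def by (rule nth_mem) (simp add: nat_less_iff Suc_le_eq)

lemma entry_add_pos: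
  assumes "length a \<ge> 1" "length b \<ge> 1"
    and "\<forall>x \<in> set a. 0 \<le> x" "\<forall>x \<in> set b. 0 \<le> x"
    and "\<not> (degenerate a \<and> degenerate b)"
  shows "0 < entry a i + entry b i"
proof -
  have "0 \<le> entry a i" "0 \<le> entry b i" "entry a i \<noteq> 0 \<or> entry b i \<noteq> 0"
    using assms entry_in_set[of a i] entry_in_set[of b i] unfolding degenerate_def by metis+
  then show ?thesis by linarith
qed

theorem theorem6p6:
  fixes n :: nat and a b a' b' :: "real list"
  assumes "n \<ge> 1"
    and "length a = n" and "length b = n"
    and "\<forall>x \<in> set a. 0 \<le> x" and "\<forall>x \<in> set b. 0 \<le> x"
    and "\<not> (degenerate a \<and> degenerate b)"
    and "theta a b = (b', a')"
  shows "whirl a \<bullet>\<^sub>m curl b = curl b' \<bullet>\<^sub>m whirl a'"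
proof (intro ext)
  fix i j :: int
  define s where "s k = entry a k + entry b k" for k
  have s_nz: "s k \<noteq> 0" for k
    using entry_add_pos[of a b k] assms unfolding s_def by simp
  have b': "entry b' k = s k * entry b (k + 1) / s (k + 1)"
    and a': "entry a' k = s k * entry a (k + 1) / s (k + 1)" for k
    using entry_theta[of a n b b' a' k] assms unfolding s_def by simp_all
  have sum': "entry b' k + entry a' k = s k" for k
  proof -
    have "entry b' k + entry a' k = s k * (entry a (k + 1) + entry b (k + 1)) / s (k + 1)"
      by (simp add: a' b' add_divide_distrib distrib_left)
    also have "\<dots> = s k"
      using s_nz[of "k + 1"] by (simp flip: s_def)
    finally show ?thesis .
  qed
  show "(whirl a \<bullet>\<^sub>m curl b) i j = (curl b' \<bullet>\<^sub>m whirl a') i j"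
  proof (cases "i < j")
    case True
    have "(whirl a \<bullet>\<^sub>m curl b) i j = s i * curl b (i + 1) j"
      using True by (simp add: whirl_mat_prod curl_split_first s_def algebra_simps)
    also have "\<dots> = curl b' i (j - 1) * s (j - 1)"
      using True prod_telescope_shift[of s i "j - 1" "entry b"] s_nz
      by (simp add: curl_eq_prod b')
    also have "\<dots> = (curl b' \<bullet>\<^sub>m whirl a') i j"
      using True by (simp add: mat_prod_whirl curl_split_last distrib_left flip: sum')
    finally show ?thesis .
  next
    case False
    then have "curl b (i + 1) j = 0" "curl b' i (j - 1) = 0" "curl b i j = curl b' i j"
      by (auto simp: curl_def)
    then show ?thesis
      by (simp add: whirl_mat_prod mat_prod_whirl)
  qed
qed

end
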